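(* Let $G$ be a bounded convex domain in $\mathbb{C}$. Then $\mathbf{r}(G)=\mathbf{r}(U_1)$.
   Context: A domain is a nonempty connected open set. $U_1=\{z\in\mathbb{C}:|z|<1\}$ is the unit disk, $\Pi=\{s\in\mathbb{C}:\Re s>0\}$, and $\Pi_{\sigma}=\{s\in\mathbb{C}:\Re s>\sigma\}$ for real $\sigma$. $H^\infty(\Pi)$ is the space of bounded holomorphic functions on $\Pi$. Rogosinski abscissa: for a domain $G\subset\mathbb{C}$, $\mathbf{r}(G)$ is the infimum of those real $\sigma'\ge 0$ such that for every $f\in H^\infty(\Pi)$ with $f(\Pi)\subset G$ that is represented in $\Pi$ by a convergent ordinary Dirichlet series $f(s)=\sum_{n=1}^\infty a_n n^{-s}$, every partial sum $P_k(s)=\sum_{n=1}^k a_n n^{-s}$ ($k\ge 1$) satisfies $P_k(\Pi_{\sigma'})\subset G$. *)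

theory Defs
  imports "HOL-Complex_Analysis.Complex_Analysis" "HOL-Library.Extended_Real"
begin

definition half_plane :: "real \<Rightarrow> complex set" where
  "half_plane \<sigma> = {s. Re s > \<sigma>}"

definition is_domain :: "complex set \<Rightarrow> bool" where
  "is_domain G \<longleftrightarrow> G \<noteq> {} \<and> open G \<and> connected G"

definition H_infinity :: "(complex \<Rightarrow> complex) set" where
  "H_infinity = {f. f holomorphic_on half_plane 0 \<and> bounded (f ` half_plane 0)}"

definition dirichlet_term :: "(nat \<Rightarrow> complex) \<Rightarrow> nat \<Rightarrow> complex \<Rightarrow> complex" where
  "dirichlet_term a n s = a n * of_nat n powr (- s)"

definition dirichlet_partial_sum :: "(nat \<Rightarrow> complex) \<Rightarrow> nat \<Rightarrow> complex \<Rightarrow> complex" where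
  "dirichlet_partial_sum a k s = (\<Sum>n=1..k. dirichlet_term a n s)"

text \<open>Convergence is that of the sequence of partial sums, so it need not be absolute.
  The shift by \<open>Suc\<close> makes the series start at index 1; the value \<open>a 0\<close> is never used.\<close>

definition represented_by :: "(complex \<Rightarrow> complex) \<Rightarrow> (nat \<Rightarrow> complex) \<Rightarrow> bool" where
  "represented_by f a \<longleftrightarrow>
     (\<forall>s\<in>half_plane 0. (\<lambda>n. dirichlet_term a (Suc n) s) sums f s)"

definition rogosinski_admissible :: "complex set \<Rightarrow> real \<Rightarrow> bool" where
  "rogosinski_admissible G \<sigma> \<longleftrightarrow>
     (\<forall>f a. f \<in> H_infinity \<and> f ` half_plane 0 \<subseteq> G \<and> represented_by f a \<longrightarrow>
        (\<forall>k\<ge>1. dirichlet_partial_sum a k ` half_plane \<sigma> \<subseteq> G))"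

text \<open>The infimum is taken in the extended reals, so that it is \<open>\<infinity>\<close> when no
  \<open>\<sigma>\<close> is admissible (a real-valued \<open>Inf\<close> would be unspecified there).\<close>

definition rogosinski_abscissa :: "complex set \<Rightarrow> ereal" where
  "rogosinski_abscissa G = Inf (ereal ` {\<sigma>. \<sigma> \<ge> 0 \<and> rogosinski_admissible G \<sigma>})"

end

theory Submission imports Defs begin

text \<open>
  The two regions have the same admissible numbers, so their abscissas agree. What makes this
  work is that a bounded Dirichlet series with values in a region may be composed with an affine
  map \<open>z \<mapsto> c + w z\<close>: this gives again such a series, whose partial sums are the images of
  the old ones. The disk and a general convex region are compared by way of half-planes.

  From the disk to \<open>G\<close>. An open convex set is the intersection of the open half-planes
  that contain it, so it suffices to treat a bounded \<open>f\<close> with \<open>Re f > 0\<close>. For \<open>d > 0\<close> the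
  values of \<open>f + d\<close> form a bounded subset of \<open>Re z > d\<close>, which lies in a disk
  \<open>|z - 1/e| < 1/e\<close> when \<open>e\<close> is small. Admissibility for the disk therefore yields
  \<open>Re (P\<^sub>k + d) > 0\<close>, and \<open>Re P\<^sub>k \<ge> 0\<close> as \<open>d\<close> tends to 0. If equality held at some
  point, the open mapping theorem would force \<open>P\<^sub>k\<close> to be constant, hence equal to the
  coefficient \<open>a\<^sub>1\<close>; but \<open>Re a\<^sub>1 > 0\<close> (lemma \<open>Re_constant_coefficient_pos\<close>), because
  far to the right \<open>f - a\<^sub>1\<close> is dominated by its first nonzero term \<open>a\<^sub>m m\<^sup>-\<^sup>s\<close>, whose argument
  takes all values on each vertical line.

  From \<open>G\<close> to the disk. Take a largest disk in \<open>G\<close> about some point \<open>c\<close>. It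
  touches the complement of \<open>G\<close> at a point \<open>p\<close>, and a supporting line of \<open>G\<close> at \<open>p\<close> is also
  tangent to the disk. Mapping the unit disk onto this one, and rotating it
  so that a given value \<open>P\<^sub>k(s)\<close> is moved in the direction of \<open>p\<close>, shows \<open>|P\<^sub>k(s)| < 1\<close>.
\<close>

section \<open>Supporting half-planes\<close>

text \<open>A weakly separating hyperplane separates strictly on an open set: if equality held at \<open>z\<close>,
  moving from \<open>z\<close> a little in the direction \<open>u\<close> would stay in the set and cross the hyperplane.\<close>

lemma open_convex_strict_support:
  fixes G :: "'a::euclidean_space set"
  assumes "open G" "convex G" "p \<notin> G"
  obtains u where "u \<noteq> 0" "\<And>z. z \<in> G \<Longrightarrow> inner u z < inner u p"
proof (cases "G = {}")
  case True
  then show ?thesis using that[of "SOME b. b \<in> Basis"] nonzero_Basis[OF SOME_Basis] by simp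
next
  case False
  have "\<exists>u b. u \<noteq> 0 \<and> (\<forall>z\<in>G. inner u z \<le> b) \<and> (\<forall>z\<in>{p}. b \<le> inner u z)"
    using assms False by (intro separating_hyperplane_sets) auto
  then obtain u b where u: "u \<noteq> 0" "\<And>z. z \<in> G \<Longrightarrow> inner u z \<le> b" "inner u p \<ge> b"
    by blast
  have "inner u z < inner u p" if "z \<in> G" for z
  proof -
    obtain e where e: "e > 0" "ball z e \<subseteq> G"
      using \<open>open G\<close> \<open>z \<in> G\<close> by (meson openE)
    define t where "t = e / (2 * norm u)"
    have "t > 0" using e(1) u(1) by (simp add: t_def)
    have "z + t *\<^sub>R u \<in> ball z e"
      using e(1) u(1) by (simp add: dist_norm t_def)
    then have "inner u (z + t *\<^sub>R u) \<le> b" by (intro u(2) subsetD[OF e(2)])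
    moreover have "inner u (z + t *\<^sub>R u) = inner u z + t * inner u u"
      by (simp add: inner_add_right)
    moreover have "t * inner u u > 0" using \<open>t > 0\<close> u(1) by simp
    ultimately show ?thesis using u(3) by linarith
  qed
  then show ?thesis using that[OF u(1)] by simp
qed

section \<open>Dirichlet series\<close>

lemma norm_dirichlet_term:
  "norm (dirichlet_term a n s) = norm (a n) * real n powr (- Re s)"
  by (cases "n = 0") (simp_all add: dirichlet_term_def norm_mult norm_powr_real_powr)

lemma dirichlet_partial_sum_affine:
  assumes "k \<ge> 1"
  shows "dirichlet_partial_sum (\<lambda>n. (if n = 1 then c else 0) + w * a n) k s
       = c + w * dirichlet_partial_sum a k s"
proof -
  have "dirichlet_term (\<lambda>n. (if n = 1 then c else 0) + w * a n) n s
      = (if n = 1 then c else 0) + w * dirichlet_term a n s" for n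
    by (simp add: dirichlet_term_def algebra_simps)
  moreover have "(\<Sum>n=1..k. if n = 1 then c else 0) = c"
    using assms by (subst sum.delta) auto
  ultimately show ?thesis
    by (simp only: dirichlet_partial_sum_def sum.distrib sum_distrib_left)
qed

lemma represented_by_affine:
  assumes "represented_by f a"
  shows "represented_by (\<lambda>s. c + w * f s) (\<lambda>n. (if n = 1 then c else 0) + w * a n)"
  unfolding represented_by_def
proof
  fix s assume "s \<in> half_plane 0"
  then have "(\<lambda>n. dirichlet_term a (Suc n) s) sums f s"
    using assms by (simp add: represented_by_def)
  moreover have "(\<lambda>n. if n = 0 then c else 0) sums c"
    using sums_single[of 0 "\<lambda>_. c"] by simp
  ultimately have "(\<lambda>n. (if n = 0 then c else 0) + w * dirichlet_term a (Suc n) s) sums (c + w * f s)"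
    by (intro sums_add sums_mult)
  moreover have "dirichlet_term (\<lambda>n. (if n = 1 then c else 0) + w * a n) (Suc n) s
      = (if n = 0 then c else 0) + w * dirichlet_term a (Suc n) s" for n
    by (simp add: dirichlet_term_def algebra_simps)
  ultimately show "(\<lambda>n. dirichlet_term (\<lambda>n. (if n = 1 then c else 0) + w * a n) (Suc n) s) sums (c + w * f s)"
    by simp
qed

lemma H_infinity_affine:
  assumes "f \<in> H_infinity"
  shows "(\<lambda>s. c + w * f s) \<in> H_infinity"
proof -
  have "bounded ((\<lambda>z. c + z) ` (\<lambda>z. w * z) ` f ` half_plane 0)"
    using assms bounded_translation bounded_linear_image[OF _ bounded_linear_mult_right]
    unfolding H_infinity_def by blast
  then show ?thesis using assms
    by (auto simp: H_infinity_def image_image intro!: holomorphic_intros)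
qed

lemma rogosinski_admissibleD_affine:
  assumes "rogosinski_admissible G \<sigma>" "f \<in> H_infinity" "represented_by f a"
    and "\<And>s. s \<in> half_plane 0 \<Longrightarrow> c + w * f s \<in> G" "k \<ge> 1" "s \<in> half_plane \<sigma>"
  shows "c + w * dirichlet_partial_sum a k s \<in> G"
proof -
  have "(\<lambda>s. c + w * f s) ` half_plane 0 \<subseteq> G" using assms(4) by blast
  with assms(1)[unfolded rogosinski_admissible_def, rule_format,
      OF conjI[OF H_infinity_affine[OF assms(2)] conjI[OF _ represented_by_affine[OF assms(3)]]]]
  have "dirichlet_partial_sum (\<lambda>n. (if n = 1 then c else 0) + w * a n) k ` half_plane \<sigma> \<subseteq> G"
    using assms(5) by simp
  then have "dirichlet_partial_sum (\<lambda>n. (if n = 1 then c else 0) + w * a n) k s \<in> G"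
    using assms(6) by blast
  then show ?thesis
    by (simp only: dirichlet_partial_sum_affine[OF assms(5)])
qed

text \<open>After \<open>m\<close> terms the remainder is \<open>o(m\<^sup>-\<^sup>x)\<close> as \<open>x = Re s\<close> grows, uniformly in the imaginary
  part. Convergence at \<open>s = 1\<close> bounds the coefficients by a multiple of \<open>n\<close>, so for \<open>x \<ge> 4\<close> the
  tail is at most a constant times \<open>(m + 1)\<^sup>3\<^sup>-\<^sup>x\<close>. The uniformity is what later allows the
  imaginary part to be chosen according to the argument of a coefficient.\<close>

lemma dirichlet_remainder:
  assumes rep: "represented_by f a" and "m \<ge> 1" and "e > 0"
  obtains x where "x > 0"
    "\<And>s. Re s = x \<Longrightarrow> norm (f s - dirichlet_partial_sum a m s) < e * real m powr (- x)"
proof -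
  have "(\<lambda>n. dirichlet_term a (Suc n) 1) sums f 1"
    using rep by (simp add: represented_by_def half_plane_def)
  then have "Bseq (\<lambda>n. dirichlet_term a (Suc n) 1)"
    using sums_summable summable_LIMSEQ_zero convergentI convergent_imp_Bseq by blast
  then obtain C where C: "C > 0" "\<And>n. norm (dirichlet_term a (Suc n) 1) \<le> C"
    by (auto simp: Bseq_def)
  have coeff: "norm (a n) \<le> C * real n" if "n \<ge> 1" for n
    using C(2)[of "n - 1"] that
    by (simp add: norm_dirichlet_term powr_minus field_simps)
  define S where "S = (\<Sum>n. 1 / real (Suc (n + m)) ^ 2)"
  have summ: "summable (\<lambda>n. 1 / real (Suc (n + m)) ^ 2)"
    using summable_ignore_initial_segment[OF inverse_power_summable[of 2, where ?'a=real], of "Suc m"]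
    by (simp add: inverse_eq_divide)
  define q where "q = real m / real (Suc m)"
  have q: "0 < q" "q < 1" using \<open>m \<ge> 1\<close> by (auto simp: q_def)
  have "(\<lambda>n. C * S * real (Suc m) ^ 3 * q ^ n) \<longlonglongrightarrow> 0"
    using q by (intro tendsto_mult_right_zero LIMSEQ_realpow_zero) auto
  then have "\<forall>\<^sub>F n in sequentially. C * S * real (Suc m) ^ 3 * q ^ n < e"
    using \<open>e > 0\<close> order_tendstoD(2) by blast
  with eventually_ge_at_top[of 4]
  have "\<forall>\<^sub>F n in sequentially. n \<ge> 4 \<and> C * S * real (Suc m) ^ 3 * q ^ n < e"
    by eventually_elim auto
  then obtain n where n: "n \<ge> 4" "C * S * real (Suc m) ^ 3 * q ^ n < e"
    using eventually_happens trivial_limit_sequentially by blast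
  define x where "x = real n"
  have x: "x \<ge> 4" "C * S * real (Suc m) ^ 3 * q powr x < e"
    using n q by (simp_all add: x_def powr_realpow)
  have powr_3: "y powr (3 - x) = y ^ 3 * y powr (- x)" if "y > 0" for y :: real
    using powr_add[of y 3 "- x"] that by simp
  have "norm (f s - dirichlet_partial_sum a m s) < e * real m powr (- x)" if s: "Re s = x" for s
  proof -
    have "(\<lambda>n. dirichlet_term a (Suc n) s) sums f s"
      using rep s x by (simp add: represented_by_def half_plane_def)
    then have tail: "(\<lambda>n. dirichlet_term a (Suc (n + m)) s) sums (f s - dirichlet_partial_sum a m s)"
      by (subst sums_iff_shift[of "\<lambda>n. dirichlet_term a (Suc n) s" m, simplified])
         (simp add: dirichlet_partial_sum_def sum.atLeast1_atMost_eq)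
    \<comment> \<open>Of the factor \<open>N\<^sup>1\<^sup>-\<^sup>x\<close>, the part \<open>N\<^sup>-\<^sup>2\<close> is kept for summability and
      \<open>N\<^sup>3\<^sup>-\<^sup>x\<close> is bounded by its value at \<open>N = m + 1\<close>.\<close>
    have le: "norm (dirichlet_term a (Suc (n + m)) s) 
        \<le> C * real (Suc m) powr (3 - x) * (1 / real (Suc (n + m)) ^ 2)" for n
    proof -
      define N where "N = real (Suc (n + m))"
      have N: "N > 0" "N \<ge> real (Suc m)" by (auto simp: N_def)
      have "norm (dirichlet_term a (Suc (n + m)) s) \<le> C * N * N powr (- x)"
        unfolding norm_dirichlet_term s N_def by (intro mult_right_mono coeff) auto
      also have "\<dots> = C * N powr (3 - x) * (1 / N ^ 2)"
        using N(1) by (simp add: powr_3 power2_eq_square power3_eq_cube)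
      also have "\<dots> \<le> C * real (Suc m) powr (3 - x) * (1 / N ^ 2)"
        using N x C(1) by (intro mult_right_mono mult_left_mono powr_mono2') auto
      finally show ?thesis by (simp add: N_def)
    qed
    have "norm (f s - dirichlet_partial_sum a m s) \<le> C * real (Suc m) powr (3 - x) * S"
      unfolding sums_unique[OF tail] S_def suminf_mult[OF summ, symmetric]
      by (intro norm_suminf_le le summable_mult summ)
    also have "\<dots> = (C * S * real (Suc m) ^ 3 * q powr x) * real m powr (- x)"
    proof -
      have "q powr x * real m powr (- x) = real (Suc m) powr (- x)"
        using \<open>m \<ge> 1\<close> by (simp add: q_def powr_divide powr_minus_divide)
      then show ?thesis by (simp add: powr_3 mult_ac)
    qed
    also have "\<dots> < e * real m powr (- x)"
      using x \<open>m \<ge> 1\<close> by (intro mult_strict_right_mono) auto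
    finally show ?thesis .
  qed
  then show ?thesis using that[of x] x(1) by simp
qed

text \<open>This is the minimum principle at \<open>+\<infinity>\<close>, where \<open>f\<close> tends to \<open>a\<^sub>1\<close>. For nonconstant \<open>f\<close> the
  leading term of \<open>f - a\<^sub>1\<close> is negative real at suitable points and dominates the
  remainder there, so \<open>f\<close> takes values with real part below \<open>Re a\<^sub>1\<close>.\<close>

lemma Re_constant_coefficient_pos:
  assumes rep: "represented_by f a" and pos: "\<And>s. s \<in> half_plane 0 \<Longrightarrow> Re (f s) > 0"
  shows "Re (a 1) > 0"
proof (cases "\<exists>n\<ge>2. a n \<noteq> 0")
  case False
  have "(\<lambda>n. dirichlet_term a (Suc n) 1) sums (\<Sum>n\<in>{0}. dirichlet_term a (Suc n) 1)"
    using False by (intro sums_finite) (auto simp: dirichlet_term_def)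
  moreover have "(\<lambda>n. dirichlet_term a (Suc n) 1) sums f 1"
    using rep by (simp add: represented_by_def half_plane_def)
  ultimately have "f 1 = a 1"
    using sums_unique2 by (fastforce simp: dirichlet_term_def)
  then show ?thesis using pos[of 1] by (simp add: half_plane_def)
next
  case True
  define m where "m = (LEAST n. n \<ge> 2 \<and> a n \<noteq> 0)"
  have m: "m \<ge> 2" "a m \<noteq> 0"
    using LeastI_ex[of "\<lambda>n. n \<ge> 2 \<and> a n \<noteq> 0"] True
    by (auto simp: m_def)
  have zero: "a n = 0" if "2 \<le> n" "n < m" for n
    using not_less_Least[of n "\<lambda>n. n \<ge> 2 \<and> a n \<noteq> 0"] that by (auto simp: m_def)
  obtain x where x: "x > 0"
    "\<And>s. Re s = x \<Longrightarrow> norm (f s - dirichlet_partial_sum a m s) < norm (a m) * real m powr (- x)"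
    using dirichlet_remainder[OF rep, of m "norm (a m)"] m by auto
  \<comment> \<open>The imaginary part \<open>t\<close> is chosen so that \<open>m\<^sup>-\<^sup>i\<^sup>t\<close> rotates \<open>a\<^sub>m\<close> to the negative real axis.\<close>
  define t where "t = (Arg (a m) - pi) / ln m"
  define s where "s = Complex x t"
  have "of_nat m powr (- s) = exp (complex_of_real (- x * ln m) + \<i> * complex_of_real (- t * ln m))"
    using m by (simp add: powr_def s_def Complex_eq Ln_of_nat algebra_simps exp_diff exp_minus exp_add divide_inverse)
  also have "\<dots> = complex_of_real (real m powr (- x)) * cis (- t * ln m)"
  proof -
    have "exp (complex_of_real (- x * ln m)) = complex_of_real (real m powr (- x))"
      using m unfolding exp_of_real by (simp add: powr_def)
    then show ?thesis by (simp only: exp_add cis_conv_exp)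
  qed
  also have "- t * ln m = pi - Arg (a m)"
    using m by (simp add: t_def)
  also have "cis (pi - Arg (a m)) = - cis (- Arg (a m))"
    using cis_mult[of pi "- Arg (a m)"] by simp
  finally have "dirichlet_term a m s = - of_real (real m powr (- x)) * (a m * cis (- Arg (a m)))"
    by (simp add: dirichlet_term_def)
  also have "a m * cis (- Arg (a m)) = of_real (norm (a m))"
  proof -
    have "rcis (norm (a m)) (Arg (a m)) * cis (- Arg (a m)) = of_real (norm (a m))"
      by (simp add: rcis_def mult.assoc cis_mult)
    then show ?thesis by (simp only: rcis_cmod_Arg)
  qed
  finally have "dirichlet_term a m s = - of_real (norm (a m) * real m powr (- x))"
    by simp
  moreover have "dirichlet_partial_sum a m s = a 1 + dirichlet_term a m s"
  proof -
    have "dirichlet_partial_sum a m s = (\<Sum>n\<in>{1,m}. dirichlet_term a n s)"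
      unfolding dirichlet_partial_sum_def
      using m zero by (intro sum.mono_neutral_right) (auto simp: dirichlet_term_def Suc_le_eq)
    then show ?thesis using m by (simp add: dirichlet_term_def)
  qed
  moreover have "norm (f s - dirichlet_partial_sum a m s) < norm (a m) * real m powr (- x)"
    using x by (simp add: s_def)
  ultimately have "Re (f s) < Re (a 1)"
    using abs_Re_le_cmod[of "f s - dirichlet_partial_sum a m s"] by simp
  moreover have "Re (f s) > 0" using pos x(1) by (simp add: s_def half_plane_def)
  ultimately show ?thesis by linarith
qed

lemma dirichlet_partial_sum_tendsto:
  assumes "k \<ge> 1"
  shows "(\<lambda>j. dirichlet_partial_sum a k (of_nat j)) \<longlonglongrightarrow> a 1"
proof -
  have "(\<lambda>j. dirichlet_term a n (of_nat j)) \<longlonglongrightarrow> (if n = 1 then a 1 else 0)"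
    if "n \<in> {1..k}" for n
  proof (cases "n = 1")
    case False
    then have n: "n > 1" using that by auto
    have "real n powr (- real j) = inverse (real n) ^ j" for j
      using n by (subst powr_minus) (simp add: powr_realpow power_inverse)
    moreover have "(\<lambda>j. norm (a n) * inverse (real n) ^ j) \<longlonglongrightarrow> 0"
      using n by (intro tendsto_mult_right_zero LIMSEQ_realpow_zero) (simp_all add: inverse_less_1_iff)
    ultimately have "(\<lambda>j. dirichlet_term a n (of_nat j)) \<longlonglongrightarrow> 0"
      by - (rule tendsto_norm_zero_cancel, simp add: norm_dirichlet_term)
    then show ?thesis using False by simp
  qed (simp add: dirichlet_term_def)
  then have "(\<lambda>j. \<Sum>n=1..k. dirichlet_term a n (of_nat j)) \<longlonglongrightarrow> (\<Sum>n=1..k. if n = 1 then a 1 else 0)"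
    by (intro tendsto_sum)
  moreover have "(\<Sum>n=1..k. if n = 1 then a 1 else 0) = a 1"
    using assms by (subst sum.delta) auto
  ultimately show ?thesis by (simp only: dirichlet_partial_sum_def)
qed

section \<open>Comparison with the disk\<close>

text \<open>The right half-plane is the increasing union of the disks \<open>|z - 1/e| < 1/e\<close>. A bounded
  \<open>f\<close> with positive real part need not have its values in a single one of them, since the values
  may approach the imaginary axis away from 0; this is why \<open>f\<close> is first shifted by \<open>d > 0\<close>.\<close>

lemma disk_admissible_imp_half_plane:
  assumes adm: "rogosinski_admissible (ball 0 1) \<sigma>"
    and f: "f \<in> H_infinity" "represented_by f a"
    and pos: "\<And>s. s \<in> half_plane 0 \<Longrightarrow> Re (f s) > 0"
    and k: "k \<ge> 1" and s: "s \<in> half_plane \<sigma>"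
  shows "Re (dirichlet_partial_sum a k s) > 0"
proof -
  let ?P = "dirichlet_partial_sum a k"
  obtain B where B: "\<And>s. s \<in> half_plane 0 \<Longrightarrow> norm (f s) \<le> B"
    using f(1) by (auto simp: H_infinity_def bounded_iff)
  have nonneg: "Re (?P z) \<ge> 0" if z: "z \<in> half_plane \<sigma>" for z
  proof (rule field_le_epsilon)
    fix d :: real assume d: "d > 0"
    define M where "M = \<bar>B\<bar> + d"
    have M: "M > 0" using d by (simp add: M_def)
    \<comment> \<open>If \<open>Re z > d\<close> and \<open>|z| \<le> M\<close>, then
      \<open>|1 - e z|\<^sup>2 = 1 - 2 e Re z + e\<^sup>2 |z|\<^sup>2 < 1 - 2 e d + e d < 1\<close>.\<close>
    define e where "e = d / M\<^sup>2"
    have e: "e > 0" using d M by (simp add: e_def)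
    have "1 - e * d + (-e) * f w \<in> ball 0 1" if w: "w \<in> half_plane 0" for w
    proof -
      define g where "g = d + f w"
      have "norm g \<le> M"
        unfolding g_def M_def using norm_triangle_ineq[of d "f w"] B[OF w] d by simp
      then have "(norm g)\<^sup>2 \<le> M\<^sup>2" by (simp add: power_mono)
      then have "e * (norm g)\<^sup>2 \<le> d" using d M by (simp add: e_def field_simps)
      moreover have "Re g > d" using pos[OF w] by (simp add: g_def)
      ultimately have "e * (e * (norm g)\<^sup>2 - 2 * Re g) < 0" using e d
        by (intro mult_pos_neg) auto
      moreover have "(norm (1 - e * g))\<^sup>2 = 1 + e * (e * (norm g)\<^sup>2 - 2 * Re g)"
        unfolding cmod_power2 by (simp add: power2_eq_square algebra_simps)
      ultimately have "(norm (1 - e * g))\<^sup>2 < 1\<^sup>2" by simp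
      then have "norm (1 - e * g) < 1" by (rule power_less_imp_less_base) simp
      then show ?thesis by (simp add: g_def algebra_simps)
    qed
    then have "1 - e * d + (-e) * ?P z \<in> ball 0 1"
      using rogosinski_admissibleD_affine[OF adm f _ k z] by blast
    then have "norm (1 - e * d + (-e) * ?P z) < 1" by simp
    then have "Re (1 - e * d + (-e) * ?P z) < 1"
      using complex_Re_le_cmod le_less_trans by blast
    then have "e * (d + Re (?P z)) > 0" by (simp add: algebra_simps)
    then show "0 \<le> Re (?P z) + d" using e by (simp add: zero_less_mult_iff)
  qed
  show ?thesis
  proof (rule ccontr)
    assume "\<not> ?thesis"
    then have zero: "Re (?P s) = 0" using nonneg[OF s] by simp
    have op: "open (half_plane \<sigma>)"
      using open_halfspace_Re_gt by (simp add: half_plane_def)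
    have "connected (half_plane \<sigma>)"
      using convex_halfspace_Re_gt by (simp add: half_plane_def convex_connected)
    have hol: "?P holomorphic_on half_plane \<sigma>"
      unfolding dirichlet_partial_sum_def dirichlet_term_def by (intro holomorphic_intros) auto
    have const: "?P constant_on half_plane \<sigma>"
    proof (rule ccontr)
      assume "\<not> ?P constant_on half_plane \<sigma>"
      then have "open (?P ` half_plane \<sigma>)"
        using open_mapping_thm[OF hol op \<open>connected _\<close> op] by blast
      then obtain e where e: "e > 0" "ball (?P s) e \<subseteq> ?P ` half_plane \<sigma>"
        using s open_contains_ball by (metis imageI)
      have "?P s - of_real (e/2) \<in> ball (?P s) e" using e by (simp add: dist_norm)
      then obtain z where "z \<in> half_plane \<sigma>" "?P z = ?P s - of_real (e/2)"
        using e by (metis (no_types, lifting) imageE subsetD)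
      then show False using nonneg[of z] zero e by simp
    qed
    then obtain c where c: "\<And>z. z \<in> half_plane \<sigma> \<Longrightarrow> ?P z = c"
      by (auto simp: constant_on_def)
    obtain N :: nat where "real N > \<sigma>" using reals_Archimedean2 by blast
    then have "?P (of_nat j) = c" if "j \<ge> N" for j
      using that by (intro c) (simp add: half_plane_def)
    then have "(\<lambda>j. ?P (of_nat j)) \<longlonglongrightarrow> c"
      by (intro tendsto_eventually eventually_sequentiallyI)
    then have "c = a 1"
      using dirichlet_partial_sum_tendsto[OF k] LIMSEQ_unique by blast
    then show False
      using Re_constant_coefficient_pos[OF f(2) pos] zero c[OF s] by simp
  qed
qed

text \<open>A partial sum with a value \<open>p\<close> outside \<open>G\<close> would violate the half-plane case for
  the series \<open>cnj u * (p - f)\<close>, where \<open>u\<close> is normal to a line through \<open>p\<close> that avoids \<open>G\<close>.\<close>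

lemma disk_admissible_imp_convex_admissible:
  assumes "open G" "convex G" and adm: "rogosinski_admissible (ball 0 1) \<sigma>"
  shows "rogosinski_admissible G \<sigma>"
  unfolding rogosinski_admissible_def
proof (intro allI impI subsetI, elim conjE imageE)
  fix f a k p s
  assume f: "f \<in> H_infinity" "f ` half_plane 0 \<subseteq> G" "represented_by f a"
    and k: "1 \<le> k" and s: "s \<in> half_plane \<sigma>" and p: "p = dirichlet_partial_sum a k s"
  show "p \<in> G"
  proof (rule ccontr)
    assume "p \<notin> G"
    then obtain u where u: "\<And>z. z \<in> G \<Longrightarrow> inner u z < inner u p"
      using open_convex_strict_support assms by blast
    define b where "b = cnj u * p"
    have "Re (b + (- cnj u) * f z) > 0" if "z \<in> half_plane 0" for z
      using u[of "f z"] f(2) that by (auto simp: b_def inner_complex_def)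
    then have "Re (dirichlet_partial_sum (\<lambda>n. (if n = 1 then b else 0) + (- cnj u) * a n) k s) > 0"
      by (intro disk_admissible_imp_half_plane[OF adm H_infinity_affine[OF f(1)]
            represented_by_affine[OF f(3)] _ k s])
    then show False
      unfolding dirichlet_partial_sum_affine[OF k] by (simp add: b_def p)
  qed
qed

text \<open>The point \<open>p\<close> below is nearest to \<open>c\<close> in the complement of \<open>G\<close>. A supporting line
  of \<open>G\<close> through \<open>p\<close> has distance at most \<open>r\<close> from \<open>c\<close>, so in the direction of its outer
  normal \<open>u\<close> the points of \<open>G\<close>, among them \<open>c + r w P\<^sub>k(s)\<close>, exceed \<open>c\<close> by less than \<open>r\<close>.\<close>

lemma convex_admissible_imp_disk_admissible:
  assumes "open G" "convex G" "G \<noteq> {}" "G \<noteq> UNIV" and adm: "rogosinski_admissible G \<sigma>"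
  shows "rogosinski_admissible (ball 0 1) \<sigma>"
  unfolding rogosinski_admissible_def
proof (intro allI impI subsetI, elim conjE imageE)
  fix f a k v s
  assume f: "f \<in> H_infinity" "f ` half_plane 0 \<subseteq> ball 0 1" "represented_by f a"
    and k: "1 \<le> k" and s: "s \<in> half_plane \<sigma>" and v: "v = dirichlet_partial_sum a k s"
  obtain c where "c \<in> G" using assms by blast
  obtain p where p: "p \<notin> G" "\<And>y. y \<notin> G \<Longrightarrow> dist c p \<le> dist c y"
    using distance_attains_inf[of "- G" c] assms by auto
  define r where "r = dist c p"
  have r: "r > 0" using p \<open>c \<in> G\<close> by (auto simp: r_def)
  have ball: "z \<in> G" if "dist c z < r" for z using p(2)[of z] that by (auto simp: r_def not_less[symmetric])
  obtain u where u: "u \<noteq> 0" "\<And>z. z \<in> G \<Longrightarrow> inner u z < inner u p"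
    using open_convex_strict_support assms p by blast
  \<comment> \<open>The unimodular factor that rotates \<open>v\<close> to the direction of \<open>u\<close>; it is 0 if \<open>v = 0\<close>.\<close>
  define w where "w = sgn (u * cnj v)"
  have w: "norm w \<le> 1" by (simp add: w_def norm_sgn)
  have "c + (r * w) * f z \<in> G" if "z \<in> half_plane 0" for z
  proof (rule ball)
    have "norm w * norm (f z) \<le> 1 * norm (f z)" using w by (intro mult_right_mono) auto
    moreover have "norm (f z) < 1" using f(2) that by auto
    ultimately have "r * (norm w * norm (f z)) < r * 1"
      using r by (intro mult_strict_left_mono) auto
    then show "dist c (c + (r * w) * f z) < r"
      using r by (simp add: dist_norm norm_mult mult.assoc)
  qed
  then have "c + (r * w) * v \<in> G"
    using rogosinski_admissibleD_affine[OF adm f(1,3) _ k s] v by blast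
  then have "inner u (r * w * v) < inner u (p - c)"
    using u(2) by (fastforce simp: inner_diff_right inner_add_right)
  also have "\<dots> \<le> norm u * r"
    using norm_cauchy_schwarz[of u "p - c"] by (simp add: r_def dist_norm norm_minus_commute)
  finally have *: "inner u (r * w * v) < norm u * r" .
  have "cnj u * w * v = of_real (norm u * norm v)"
  proof (cases "v = 0")
    case False
    have "cnj u * w * v = (cnj u * u) * (cnj v * v) / of_real (norm u * norm v)"
      by (simp add: w_def sgn_eq norm_mult)
    then show ?thesis using False u(1)
      by (simp add: complex_norm_square[symmetric] mult.commute power2_eq_square)
  qed simp
  moreover have "inner u (r * w * v) = Re (r * (cnj u * w * v))"
    by (simp add: inner_complex_def algebra_simps)
  ultimately have "inner u (r * w * v) = r * (norm u * norm v)"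
    by simp
  with * have "norm v < 1" using r u(1) by (simp add: mult.commute)
  then show "v \<in> ball 0 1" by simp
qed

theorem theorem2p3:
  fixes G :: "complex set"
  assumes "is_domain G" and "bounded G" and "convex G"
  shows "rogosinski_abscissa G = rogosinski_abscissa (ball 0 1)"
proof -
  have "open G" "G \<noteq> {}" using assms(1) by (simp_all add: is_domain_def)
  moreover have "G \<noteq> UNIV" using assms(2) not_bounded_UNIV by metis
  ultimately have "rogosinski_admissible G \<sigma> \<longleftrightarrow> rogosinski_admissible (ball 0 1) \<sigma>" for \<sigma>
    using disk_admissible_imp_convex_admissible[OF _ assms(3)]
      convex_admissible_imp_disk_admissible[OF _ assms(3)] by metis
  then show ?thesis by (simp add: rogosinski_abscissa_def)
qed

end
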